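(* Let $a_0\in\mathbb{C}$ and $r_0>0$ be such that $\overline{D(a_0,r_0)}\subset\mathbb{D}$, and let $f$ be a function that is analytic and nonvanishing in a neighborhood of $\overline{D(a_0,r_0)}$. Then $f$ can be uniformly approximated on $D(a_0,r_0)$ by a polynomial with zeros on the unit circle; that is, for every $\varepsilon>0$ there exists a polynomial $q$, all of whose zeros lie on $\{z:|z|=1\}$, such that $|f(z)-q(z)|<\varepsilon$ for all $z\in D(a_0,r_0)$.
   Context: $\mathbb{D}=\{z\in\mathbb{C}:|z|<1\}$, and $D(a,s)=\{z\in\mathbb{C}:|z-a|<s\}$ is the open Euclidean disc. *)

theory Defs
  imports
    "HOL-Complex_Analysis.Complex_Analysis"
    "HOL-Computational_Algebra.Polynomial"
begin

end

theory Submission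
  imports Defs
begin

text \<open>
  On a slightly larger disc \<open>f = exp h\<close>. A Taylor polynomial \<open>g\<close> of \<open>h\<close> gives an entire zero-free
  approximation \<open>exp g\<close> of \<open>f\<close>, and replacing \<open>exp\<close> by one of its Taylor polynomials yields a
  polynomial \<open>p\<close> close to \<open>f\<close> without zeros in the closed unit disc. With the conjugate reciprocal
  \<open>p\<^sup>*(z) = z\<^sup>d cnj (p (1 / cnj z))\<close>, \<open>d = degree p\<close>, the maximum principle gives
  \<open>|p\<^sup>*| \<le> |p|\<close> on the unit disc. Hence \<open>p + z\<^sup>m p\<^sup>*\<close> has no zeros inside the unit disc for
  \<open>m \<ge> 1\<close>, and, being self-inversive, none outside either. Finally \<open>z\<^sup>m p\<^sup>*\<close> tends to \<open>0\<close> uniformly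
  on compact subsets of the unit disc.
\<close>

text \<open>The Taylor series at the centre converges uniformly on closed discs of radius below its
  radius of convergence, so a partial sum serves as \<open>p\<close>.\<close>

lemma holomorphic_on_ball_approx_poly:
  assumes hol: "f holomorphic_on ball z R" and r: "r < R" and e: "e > 0"
  obtains p :: "complex poly" where "\<And>w. w \<in> cball z r \<Longrightarrow> cmod (f w - poly p w) < e"
proof -
  define a where "a = (\<lambda>n. (deriv ^^ n) f z / fact n)"
  have sums: "(\<lambda>n. a n * (w - z) ^ n) sums f w" if "w \<in> ball z R" for w
    using holomorphic_power_series[OF hol that] by (simp add: a_def)
  \<comment> \<open>It suffices that the series converges at one point of each modulus below
    \<open>R\<close>; the points \<open>z + r'\<close> with \<open>r'\<close> real are used.\<close>
  have "conv_radius a \<ge> ereal R"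
  proof (rule conv_radius_geI_ex')
    fix r' :: real assume "0 < r'" "ereal r' < ereal R"
    then have "z + of_real r' \<in> ball z R"
      by (simp add: dist_norm)
    from sums[OF this] show "summable (\<lambda>n. a n * of_real r' ^ n)"
      by (simp add: sums_iff)
  qed
  then have "ereal r < conv_radius a"
    using r by (meson ereal_less_eq(3) less_ereal.simps(1) less_le_trans)
  from uniform_limitD[OF powser_uniform_limit[OF this] e]
  obtain N where N: "\<And>w. w \<in> cball z r \<Longrightarrow>
      dist (\<Sum>i<N. a i * (w - z) ^ i) (\<Sum>i. a i * (w - z) ^ i) < e"
    unfolding eventually_sequentially by blast
  define p where "p = (\<Sum>i<N. smult (a i) ([:- z, 1:] ^ i))"
  show thesis
  proof (rule that)
    fix w assume w: "w \<in> cball z r"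
    then have "w \<in> ball z R"
      using r by simp
    from sums[OF this] have "(\<Sum>i. a i * (w - z) ^ i) = f w"
      by (simp add: sums_iff)
    moreover have "poly p w = (\<Sum>i<N. a i * (w - z) ^ i)"
      by (simp add: p_def poly_sum)
    ultimately show "cmod (f w - poly p w) < e"
      using N[OF w] by (simp add: dist_norm norm_minus_commute)
  qed
qed

text \<open>By compactness some \<open>e\<close>-neighbourhood of the closed ball lies in
  \<open>U\<close>, and every point of the ball of radius \<open>r + e\<close> is within
  \<open>e\<close> of the closed ball.\<close>

lemma cball_subset_open_enlarge:
  fixes a :: "'a::{real_normed_vector, heine_borel}"
  assumes "r > 0" "open U" "cball a r \<subseteq> U"
  obtains R where "R > r" "ball a R \<subseteq> U"
proof -
  obtain e where e: "e > 0" "(\<Union>x\<in>cball a r. ball x e) \<subseteq> U"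
    using compact_subset_open_imp_ball_epsilon_subset[OF compact_cball assms(2,3)] by blast
  have "ball a (r + e) \<subseteq> U"
  proof
    fix w assume w: "w \<in> ball a (r + e)"
    define d where "d = dist a w"
    show "w \<in> U"
    proof (cases "d \<le> r")
      case True
      then show ?thesis using assms(3) by (auto simp: d_def)
    next
      case False
      \<comment> \<open>The radial projection of \<open>w\<close> onto the sphere of radius
        \<open>r\<close>.\<close>
      define x where "x = a + (r / d) *\<^sub>R (w - a)"
      have d: "d > 0" using False assms(1) by linarith
      have nd: "norm (w - a) = d" by (simp add: d_def dist_norm norm_minus_commute)
      have "dist a x = r"
        using d assms(1) by (simp add: x_def dist_norm nd)
      moreover have "dist x w = d - r"
      proof -
        have "w - x = (1 - r / d) *\<^sub>R (w - a)"
          by (simp add: x_def algebra_simps)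
        then have "norm (w - x) = \<bar>1 - r / d\<bar> * d"
          by (simp add: nd)
        also have "\<dots> = d - r"
          using False d by (simp add: left_diff_distrib)
        finally show ?thesis
          by (simp add: dist_norm norm_minus_commute)
      qed
      moreover have "d < r + e" using w by (simp add: d_def)
      ultimately have "x \<in> cball a r" "w \<in> ball x e" by auto
      then show ?thesis using e(2) by blast
    qed
  qed
  then show thesis using that[of "r + e"] e(1) by simp
qed

text \<open>Reversing the conjugated coefficients yields an honest polynomial, which also has the
  right value at 0, where the formula with \<open>1 / cnj z\<close> breaks down.\<close>

definition conj_reciprocal :: "complex poly \<Rightarrow> complex poly" where
  "conj_reciprocal p = reflect_poly (map_poly cnj p)"

lemma poly_conj_reciprocal:
  assumes "z \<noteq> 0"
  shows "poly (conj_reciprocal p) z = z ^ degree p * cnj (poly p (inverse (cnj z)))"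
  using assms by (simp add: conj_reciprocal_def poly_reflect_poly_nz degree_map_poly)

text \<open>On the unit circle \<open>1 / cnj z = z\<close>, so the two moduli agree there. The
  quotient has no poles in the closed disc, and the maximum principle carries the bound 1
  inside.\<close>

lemma cmod_conj_reciprocal_le:
  assumes nz: "\<And>z. cmod z \<le> 1 \<Longrightarrow> poly p z \<noteq> 0" and z: "cmod z \<le> 1"
  shows "cmod (poly (conj_reciprocal p) z) \<le> cmod (poly p z)"
proof -
  let ?h = "\<lambda>z. poly (conj_reciprocal p) z / poly p z"
  have "cmod (?h z) \<le> 1"
  proof (rule maximum_modulus_frontier[of ?h "cball 0 1"])
    show "?h holomorphic_on interior (cball 0 1)"
      by (intro holomorphic_intros) (auto intro!: nz)
    show "continuous_on (closure (cball 0 1)) ?h"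
      by (intro continuous_intros) (auto intro!: nz)
    fix w :: complex assume "w \<in> frontier (cball 0 1)"
    then have w: "cmod w = 1" by simp
    then have "w * cnj w = 1"
      by (simp add: complex_norm_square[symmetric])
    then have "inverse (cnj w) = w"
      by (metis inverse_unique mult.commute)
    moreover have "w \<noteq> 0" using w by auto
    ultimately have "poly (conj_reciprocal p) w = w ^ degree p * cnj (poly p w)"
      by (simp add: poly_conj_reciprocal)
    then show "cmod (?h w) \<le> 1"
      using w nz[of w] by (simp add: norm_divide norm_mult norm_power)
  qed (use z in auto)
  then show ?thesis
    using nz[OF z] by (simp add: norm_divide divide_simps split: if_splits)
qed

lemma zeros_add_conj_reciprocal:
  assumes nz: "\<And>z. cmod z \<le> 1 \<Longrightarrow> poly p z \<noteq> 0" and m: "m > 0"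
    and zero: "poly (p + monom 1 m * conj_reciprocal p) z = 0"
  shows "cmod z = 1"
proof -
  \<comment> \<open>Stated for arbitrary \<open>w\<close>, since it is applied both to
    \<open>z\<close> and to its reflection in the unit circle. Strictness comes from
    \<open>m > 0\<close> and \<open>poly p w \<noteq> 0\<close>.\<close>
  have inside: False if "cmod w < 1" "poly p w + w ^ m * poly (conj_reciprocal p) w = 0" for w
  proof -
    have "cmod (poly p w) = cmod w ^ m * cmod (poly (conj_reciprocal p) w)"
      using that(2) by (metis add_eq_0_iff norm_minus_cancel norm_mult norm_power)
    also have "\<dots> \<le> cmod w ^ m * cmod (poly p w)"
      using that(1) by (intro mult_left_mono cmod_conj_reciprocal_le nz) auto
    also have "\<dots> < 1 * cmod (poly p w)"
      using that(1) m nz[of w] by (intro mult_strict_right_mono) (auto simp: power_less_one_iff)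
    finally show False by simp
  qed
  have zero': "poly p z + z ^ m * poly (conj_reciprocal p) z = 0"
    using zero by (simp add: poly_monom)
  have False if z: "cmod z > 1"
  proof (rule inside)
    define w where "w = inverse (cnj z)"
    have z0: "z \<noteq> 0" "w \<noteq> 0" "inverse (cnj w) = z" using z by (auto simp: w_def)
    show "cmod w < 1"
      using z by (simp add: w_def norm_inverse inverse_less_1_iff)
    \<comment> \<open>Conjugating this equation and multiplying by \<open>w ^ (m + degree p)\<close>
      exchanges the roles of \<open>z\<close> and \<open>w\<close>, so the reflected point
      \<open>w\<close> is a zero as well.\<close>
    have "poly p z + z ^ (m + degree p) * cnj (poly p w) = 0"
      using zero' z0 by (simp add: poly_conj_reciprocal w_def power_add mult.assoc)
    then have "cnj (poly p z) + cnj z ^ (m + degree p) * poly p w = 0"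
      by (metis complex_cnj_add complex_cnj_cnj complex_cnj_mult complex_cnj_power complex_cnj_zero)
    moreover have "w ^ (m + degree p) * cnj z ^ (m + degree p) = 1"
      using z0 by (simp add: w_def flip: power_mult_distrib)
    ultimately have "w ^ (m + degree p) * cnj (poly p z) + poly p w = 0"
      by (metis (no_types, lifting) distrib_left mult.assoc mult_1 mult_zero_right)
    then show "poly p w + w ^ m * poly (conj_reciprocal p) w = 0"
      using z0 by (simp add: poly_conj_reciprocal power_add algebra_simps)
  qed
  with inside[OF _ zero'] show ?thesis by (meson linorder_neqE_linordered_idom)
qed

lemma approx_unit_circle_zeros:
  assumes nz: "\<And>z. cmod z \<le> 1 \<Longrightarrow> poly p z \<noteq> 0" and s: "s < 1" and e: "e > 0"
  obtains q :: "complex poly" where "\<And>z. poly q z = 0 \<Longrightarrow> cmod z = 1"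
    "\<And>z. cmod z \<le> s \<Longrightarrow> cmod (poly p z - poly q z) < e"
proof -
  have "bounded (poly (conj_reciprocal p) ` cball 0 1)"
    by (intro compact_imp_bounded compact_continuous_image continuous_intros compact_cball)
  then obtain C where C: "C > 0" "\<And>z. cmod z \<le> 1 \<Longrightarrow> cmod (poly (conj_reciprocal p) z) \<le> C"
    unfolding bounded_pos by auto
  \<comment> \<open>\<open>s\<close> may be negative; the powers of \<open>t\<close> are nonnegative
    and tend to 0 in every case.\<close>
  define t where "t = max s 0"
  have t: "0 \<le> t" "t < 1" using s by (auto simp: t_def)
  have "(\<lambda>m. t ^ m) \<longlonglongrightarrow> 0" using t by (intro LIMSEQ_realpow_zero)
  then have "\<forall>\<^sub>F m in sequentially. t ^ m < e / C"
    using e C(1) by (intro order_tendstoD) auto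
  then have "\<forall>\<^sub>F m in sequentially. t ^ m < e / C \<and> m > 0"
    using eventually_gt_at_top by (rule eventually_conj)
  then obtain m where m: "t ^ m < e / C" "m > 0"
    using eventually_happens'[OF sequentially_bot] by blast
  show thesis
  proof (rule that)
    show "cmod z = 1" if "poly (p + monom 1 m * conj_reciprocal p) z = 0" for z
      using nz m(2) that by (rule zeros_add_conj_reciprocal)
    fix z assume z: "cmod z \<le> s"
    have "cmod (poly p z - poly (p + monom 1 m * conj_reciprocal p) z)
        = cmod z ^ m * cmod (poly (conj_reciprocal p) z)"
      by (simp add: poly_monom norm_mult norm_power)
    also have "\<dots> \<le> t ^ m * C"
      using z s t by (intro mult_mono power_mono C) (auto simp: t_def)
    also have "\<dots> < e" using m(1) C(1) by (simp add: field_simps)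
    finally show "cmod (poly p z - poly (p + monom 1 m * conj_reciprocal p) z) < e" .
  qed
qed

text \<open>If \<open>|g| \<le> M\<close> on the unit disc, then
  \<open>|exp g| \<ge> exp (- M)\<close> there, so an error below \<open>exp (- M)\<close> cannot
  create a zero.\<close>

lemma approx_exp_poly_zero_free:
  fixes g :: "complex poly"
  assumes e: "e > 0"
  obtains p where "\<And>z. cmod z \<le> 1 \<Longrightarrow> poly p z \<noteq> 0"
    "\<And>z. cmod z \<le> 1 \<Longrightarrow> cmod (exp (poly g z) - poly p z) < e"
proof -
  have "bounded (poly g ` cball 0 1)"
    by (intro compact_imp_bounded compact_continuous_image continuous_intros compact_cball)
  then obtain M where M: "\<And>z. cmod z \<le> 1 \<Longrightarrow> cmod (poly g z) \<le> M"
    unfolding bounded_iff by (metis imageI mem_cball_0)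
  have "exp holomorphic_on ball 0 (M + 1)" by (intro holomorphic_intros)
  then obtain E where E: "\<And>w. w \<in> cball 0 M \<Longrightarrow> cmod (exp w - poly E w) < min e (exp (- M))"
    using holomorphic_on_ball_approx_poly[of exp 0 "M + 1" M "min e (exp (- M))"] e by auto
  have close: "cmod (exp (poly g z) - poly (pcompose E g) z) < min e (exp (- M))"
    if "cmod z \<le> 1" for z
    using E[of "poly g z"] M[OF that] by (simp add: poly_pcompose)
  show thesis
  proof (rule that)
    fix z :: complex assume z: "cmod z \<le> 1"
    show "cmod (exp (poly g z) - poly (pcompose E g) z) < e" using close[OF z] by simp
    have "- M \<le> Re (poly g z)"
      using M[OF z] abs_Re_le_cmod[of "poly g z"] by linarith
    then have "exp (- M) \<le> cmod (exp (poly g z))" by simp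
    with close[OF z] show "poly (pcompose E g) z \<noteq> 0" by auto
  qed
qed

text \<open>A disc is contractible, so \<open>f = exp h\<close> on it. For a polynomial
  \<open>g\<close> near \<open>h\<close>, the error is \<open>f * (1 - exp (g - h))\<close>, small
  because \<open>f\<close> is bounded on the smaller closed disc.\<close>

lemma nonvanishing_approx_exp_poly:
  assumes hol: "f holomorphic_on ball a R" and nz: "\<And>z. z \<in> ball a R \<Longrightarrow> f z \<noteq> 0"
    and r: "r < R" and e: "e > 0"
  obtains g :: "complex poly" where "\<And>z. z \<in> cball a r \<Longrightarrow> cmod (f z - exp (poly g z)) < e"
proof -
  obtain h where h: "h holomorphic_on ball a R" "\<And>z. z \<in> ball a R \<Longrightarrow> f z = exp (h z)"
    using contractible_imp_holomorphic_log[OF hol convex_imp_contractible[OF convex_ball] nz] by blast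
  have sub: "cball a r \<subseteq> ball a R" using r by auto
  have "bounded (f ` cball a r)"
    by (intro compact_imp_bounded compact_continuous_image compact_cball
        continuous_on_subset[OF holomorphic_on_imp_continuous_on[OF hol] sub])
  then obtain B where B: "B > 0" "\<And>z. z \<in> cball a r \<Longrightarrow> cmod (f z) \<le> B"
    unfolding bounded_pos by auto
  have "isCont (exp :: complex \<Rightarrow> complex) 0" by (intro continuous_intros)
  then obtain d where d: "d > 0" "\<And>x :: complex. cmod x < d \<Longrightarrow> cmod (exp x - 1) < e / B"
    unfolding continuous_at_eps_delta dist_norm using e B(1) by (metis diff_zero divide_pos_pos exp_zero)
  obtain g where g: "\<And>w. w \<in> cball a r \<Longrightarrow> cmod (h w - poly g w) < d"
    using holomorphic_on_ball_approx_poly[OF h(1) r d(1)] by blast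
  show thesis
  proof (rule that)
    fix z assume z: "z \<in> cball a r"
    have "f z * (1 - exp (poly g z - h z)) = f z - exp (poly g z)"
      using h(2)[of z] z sub by (auto simp: algebra_simps simp flip: exp_add)
    then have "cmod (f z - exp (poly g z)) = cmod (f z) * cmod (exp (poly g z - h z) - 1)"
      by (metis norm_minus_commute norm_mult)
    also have "\<dots> \<le> B * cmod (exp (poly g z - h z) - 1)"
      using B(2)[OF z] by (intro mult_right_mono) auto
    also have "\<dots> < B * (e / B)"
      using g[OF z] B(1) by (intro mult_strict_left_mono d) (simp_all add: norm_minus_commute)
    also have "\<dots> = e" using B(1) by simp
    finally show "cmod (f z - exp (poly g z)) < e" .
  qed
qed

theorem theorem3p1:
  fixes a\<^sub>0 :: complex and r\<^sub>0 :: real and f :: "complex \<Rightarrow> complex" and U :: "complex set"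
  assumes "r\<^sub>0 > 0"
    and "closure (ball a\<^sub>0 r\<^sub>0) \<subseteq> ball 0 1"
    and "open U" and "closure (ball a\<^sub>0 r\<^sub>0) \<subseteq> U"
    and "f analytic_on U" and "\<forall>z\<in>U. f z \<noteq> 0"
  shows "\<forall>\<epsilon>>0. \<exists>q :: complex poly.
           (\<forall>z. poly q z = 0 \<longrightarrow> cmod z = 1) \<and>
           (\<forall>z\<in>ball a\<^sub>0 r\<^sub>0. cmod (f z - poly q z) < \<epsilon>)"
proof (intro allI impI)
  fix \<epsilon> :: real assume "\<epsilon> > 0"
  \<comment> \<open>One third for each of the replacements of \<open>f\<close> by
    \<open>exp g\<close>, of \<open>exp g\<close> by \<open>p\<close>, and of \<open>p\<close> by
    \<open>q\<close>.\<close>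
  then have e3: "\<epsilon> / 3 > 0" by simp
  have cb: "cball a\<^sub>0 r\<^sub>0 \<subseteq> ball 0 1" "cball a\<^sub>0 r\<^sub>0 \<subseteq> U"
    using assms by auto
  \<comment> \<open>The radius of a disc about 0 that contains the given disc; it is below 1 because
    the closed disc lies in the open unit disc.\<close>
  define s where "s = cmod a\<^sub>0 + r\<^sub>0"
  have s: "s < 1" using cb(1) assms(1) by (simp add: cball_subset_ball_iff s_def)
  obtain R where R: "R > r\<^sub>0" "ball a\<^sub>0 R \<subseteq> U"
    using cball_subset_open_enlarge[OF assms(1,3) cb(2)] by blast
  have "f holomorphic_on ball a\<^sub>0 R"
    using R(2) assms(5) analytic_imp_holomorphic analytic_on_subset by blast
  moreover have "f z \<noteq> 0" if "z \<in> ball a\<^sub>0 R" for z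
    using R(2) assms(6) that by blast
  ultimately obtain g where g: "\<And>z. z \<in> cball a\<^sub>0 r\<^sub>0 \<Longrightarrow> cmod (f z - exp (poly g z)) < \<epsilon> / 3"
    using nonvanishing_approx_exp_poly[OF _ _ R(1) e3] by blast
  obtain p where p: "\<And>z. cmod z \<le> 1 \<Longrightarrow> poly p z \<noteq> 0"
    "\<And>z. cmod z \<le> 1 \<Longrightarrow> cmod (exp (poly g z) - poly p z) < \<epsilon> / 3"
    using approx_exp_poly_zero_free[OF e3] by blast
  obtain q where q: "\<And>z. poly q z = 0 \<Longrightarrow> cmod z = 1"
    "\<And>z. cmod z \<le> s \<Longrightarrow> cmod (poly p z - poly q z) < \<epsilon> / 3"
    using approx_unit_circle_zeros[OF p(1) s e3] by blast
  have "cmod (f z - poly q z) < \<epsilon>" if "z \<in> ball a\<^sub>0 r\<^sub>0" for z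
  proof -
    have "cmod z \<le> s"
      using that norm_triangle_sub[of z a\<^sub>0] by (simp add: s_def dist_norm norm_minus_commute)
    then have "cmod (f z - exp (poly g z)) < \<epsilon> / 3" "cmod (exp (poly g z) - poly p z) < \<epsilon> / 3"
      "cmod (poly p z - poly q z) < \<epsilon> / 3"
      using g p(2) q(2) s that by auto
    then show ?thesis by norm
  qed
  with q(1) show "\<exists>q. (\<forall>z. poly q z = 0 \<longrightarrow> cmod z = 1) \<and> (\<forall>z\<in>ball a\<^sub>0 r\<^sub>0. cmod (f z - poly q z) < \<epsilon>)"
    by blast
qed

end
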